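(* Let $(X,\rho)$ be a finite ultrametric space with $\operatorname{card}X\geqslant 2$. Then the inequality $$\operatorname{card}\operatorname{DP}(X)\geqslant 2(\operatorname{card}X-1)$$ holds. Equality $\operatorname{card}\operatorname{DP}(X)=2(\operatorname{card}X-1)$ is attained if and only if there is a (nonempty) ultrametric space $(Y,d)$ such that $(X,\rho)$ is isometric to a one-point extension $(Y_a,d_a)$ of $(Y,d)$ (for some point $a\notin Y$ and some real $t>\operatorname{diam}Y$).
   Context: An ultrametric on a set $X$ is a metric $\rho:X\times X\to[0,\infty)$ satisfying $\rho(x,y)\leqslant\max\{\rho(x,z),\rho(z,y)\}$ for all $x,y,z\in X$. $\operatorname{diam}X=\sup\{\rho(x,y):x,y\in X\}$. For a nonempty finite ultrametric space $(X,\rho)$, $\operatorname{DP}(X)=\{(x,y)\in X\times X:\rho(x,y)=\operatorname{diam}X\}$ is the set of all ordered pairs of points at distance $\operatorname{diam}X$. One-point extension $(Y_a,d_a)$: let $(Y,d)$ be a nonempty ultrametric space, $a$ a point with $a\notin Y$, and $t$ a real number with $\operatorname{diam}Y<t$. Put $Y_a=Y\cup\{a\}$ and define $d_a(x,y)=d(x,y)$ if $x,y\in Y$; $d_a(a,a)=0$; and $d_a(x,y)=t$ if ($x\in Y$ and $y=a$) or ($y\in Y$ and $x=a$). *)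

theory Defs
  imports "HOL-Analysis.Analysis"
begin

locale Ultrametric_space = Metric_space +
  assumes ultrametric:
    "\<And>x y z. \<lbrakk>x \<in> M; y \<in> M; z \<in> M\<rbrakk> \<Longrightarrow> d x y \<le> max (d x z) (d z y)"

(* Valued in ereal so that an unbounded space has diameter \<infinity>; on real, Sup of an
   unbounded set is unspecified. Only used for nonempty X. *)
definition diam :: "'a set \<Rightarrow> ('a \<Rightarrow> 'a \<Rightarrow> real) \<Rightarrow> ereal" where
  "diam X \<rho> = (SUP (x, y) \<in> X \<times> X. ereal (\<rho> x y))"

definition DP :: "'a set \<Rightarrow> ('a \<Rightarrow> 'a \<Rightarrow> real) \<Rightarrow> ('a \<times> 'a) set" where
  "DP X \<rho> = {(x, y) \<in> X \<times> X. ereal (\<rho> x y) = diam X \<rho>}"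

definition isometric ::
  "'a set \<Rightarrow> ('a \<Rightarrow> 'a \<Rightarrow> real) \<Rightarrow> 'b set \<Rightarrow> ('b \<Rightarrow> 'b \<Rightarrow> real) \<Rightarrow> bool" where
  "isometric X \<rho> Z \<sigma> \<longleftrightarrow>
     (\<exists>f. bij_betw f X Z \<and> (\<forall>x\<in>X. \<forall>y\<in>X. \<sigma> (f x) (f y) = \<rho> x y))"

(* The metric of the one-point extension, whose carrier is insert a Y. The final branch
   covers d_a(a,a) = 0; elsewhere it only assigns 0 to pairs not both in insert a Y. *)
definition ext_dist ::
  "'a set \<Rightarrow> ('a \<Rightarrow> 'a \<Rightarrow> real) \<Rightarrow> 'a \<Rightarrow> real \<Rightarrow> 'a \<Rightarrow> 'a \<Rightarrow> real" where
  "ext_dist Y d a t x y =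
     (if x \<in> Y \<and> y \<in> Y then d x y
      else if (x \<in> Y \<and> y = a) \<or> (y \<in> Y \<and> x = a) then t
      else 0)"

definition isometric_to_one_point_extension ::
  "'a set \<Rightarrow> ('a \<Rightarrow> 'a \<Rightarrow> real) \<Rightarrow> 'b set \<Rightarrow> ('b \<Rightarrow> 'b \<Rightarrow> real) \<Rightarrow> bool" where
  "isometric_to_one_point_extension X \<rho> Y d \<longleftrightarrow>
     (\<exists>a t. a \<notin> Y \<and> diam Y d < ereal t \<and> isometric X \<rho> (insert a Y) (ext_dist Y d a t))"

end

theory Submission
  imports Defs
begin

text \<open>
  Let \<open>D\<close> be the diameter and \<open>\<rho> p q = D\<close>. By the ultrametric inequality every point of the
  open ball \<open>B\<close> of radius \<open>D\<close> around \<open>p\<close> is at distance exactly \<open>D\<close> from every point of its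
  complement \<open>C\<close>, so \<open>B \<times> C \<union> C \<times> B\<close>, of size \<open>2|B||C| \<ge> 2(|B| + |C| - 1)\<close>, consists of
  diametrical pairs. Equality forces \<open>B\<close> or \<open>C\<close> to be a singleton \<open>{a}\<close> and all diametrical
  pairs to involve \<open>a\<close>, so that \<open>X - {a}\<close> has diameter less than \<open>D\<close>.
\<close>

lemma dist_le_diam:
  assumes "x \<in> X" "y \<in> X"
  shows "ereal (\<rho> x y) \<le> diam X \<rho>"
  unfolding diam_def by (rule SUP_upper2[of "(x, y)"]) (use assms in auto)

lemma diam_leI:
  assumes "\<And>x y. x \<in> X \<Longrightarrow> y \<in> X \<Longrightarrow> ereal (\<rho> x y) \<le> c"
  shows "diam X \<rho> \<le> c"
  unfolding diam_def by (rule SUP_least) (use assms in auto)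

text \<open>A supremum over a finite nonempty set is a maximum. This turns the extended-real
  diameter into an actual distance.\<close>

lemma diam_attained:
  assumes "finite X" "X \<noteq> {}"
  obtains p q where "p \<in> X" "q \<in> X" "diam X \<rho> = ereal (\<rho> p q)"
proof -
  let ?A = "(\<lambda>(x, y). ereal (\<rho> x y)) ` (X \<times> X)"
  have "Sup ?A = Max ?A" "Max ?A \<in> ?A"
    using assms by (auto intro!: Max_Sup[symmetric] Max_in)
  then have "diam X \<rho> \<in> ?A"
    by (simp add: diam_def)
  then show thesis
    using that by auto
qed

lemma card_Times_Un_swap:
  assumes "finite B" "finite C" "B \<inter> C = {}"
  shows "card (B \<times> C \<union> C \<times> B) = 2 * (card B * card C)"
proof -
  have "(B \<times> C) \<inter> (C \<times> B) = {}"
    using assms(3) by auto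
  then show ?thesis
    using assms(1,2) by (simp add: card_Un_disjoint card_cartesian_product)
qed

text \<open>Both parts come from b c + 1 - (b + c) = (b - 1) (c - 1), which is nonnegative and
  vanishes only if a factor does.\<close>

lemma add_le_Suc_mult:
  fixes b c :: nat
  assumes "b \<ge> 1" "c \<ge> 1"
  shows "b + c \<le> Suc (b * c)" "Suc (b * c) = b + c \<Longrightarrow> b = 1 \<or> c = 1"
proof -
  obtain i j where "b = Suc i" "c = Suc j"
    using assms by (metis Suc_le_D One_nat_def)
  then show "b + c \<le> Suc (b * c)" "Suc (b * c) = b + c \<Longrightarrow> b = 1 \<or> c = 1"
    by auto
qed

lemma DP_separation:
  assumes "Ultrametric_space X \<rho>" "finite X" "card X \<ge> 2"
  obtains B C where "B \<union> C = X" "B \<inter> C = {}" "B \<noteq> {}" "C \<noteq> {}"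
    "B \<times> C \<union> C \<times> B \<subseteq> DP X \<rho>"
proof -
  interpret Ultrametric_space X \<rho> by fact
  have "X \<noteq> {}"
    using assms(3) by auto
  with assms(2) obtain p q where pq: "p \<in> X" "q \<in> X" and D: "diam X \<rho> = ereal (\<rho> p q)"
    by (rule diam_attained)
  have le: "\<rho> x y \<le> \<rho> p q" if "x \<in> X" "y \<in> X" for x y
    using dist_le_diam[of x X y \<rho>] that D by simp
  \<comment> \<open>Positivity puts \<open>p\<close> itself into the open ball \<open>B\<close>, so
    that \<open>B\<close> is nonempty.\<close>
  have pos: "\<rho> p q > 0"
  proof -
    obtain x y where "x \<in> X" "y \<in> X" "x \<noteq> y"
      using assms(3) by (metis card_le_Suc0_iff_eq assms(2) not_less_eq_eq numeral_2_eq_2)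
    then show ?thesis
      using le[of x y] mdist_pos_less[of x y] by linarith
  qed
  define B where "B = {x \<in> X. \<rho> p x < \<rho> p q}"
  define C where "C = {x \<in> X. \<not> \<rho> p x < \<rho> p q}"
  \<comment> \<open>From \<rho> p c \<le> max (\<rho> p b) (\<rho> b c) and \<rho> p b < \<rho> p q
    \<le> \<rho> p c, the maximum must be \<rho> b c, so \<rho> b c \<ge> \<rho> p q.\<close>
  have BC: "\<rho> b c = \<rho> p q" if "b \<in> B" "c \<in> C" for b c
    using that ultrametric[of p c b] le[of b c] pq by (auto simp: B_def C_def)
  moreover have "\<rho> c b = \<rho> p q" if "b \<in> B" "c \<in> C" for b c
    using BC[OF that] commute[of b c] that by (simp add: B_def C_def)
  moreover have "B \<subseteq> X" "C \<subseteq> X"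
    by (auto simp: B_def C_def)
  ultimately have "B \<times> C \<union> C \<times> B \<subseteq> DP X \<rho>"
    by (auto simp: DP_def D)
  moreover have "p \<in> B" "q \<in> C"
    using pq pos by (auto simp: B_def C_def)
  ultimately show thesis
    by (intro that[of B C]) (auto simp: B_def C_def)
qed

text \<open>If \<open>p\<close> is the point of \<open>X\<close> sent to \<open>a\<close>, a pair is
  diametrical exactly when one of its two entries is \<open>p\<close>. The types of \<open>X\<close>
  and \<open>Y\<close> are independent.\<close>

lemma card_DP_one_point_extension:
  assumes "finite X" "Ultrametric_space Y d" "Y \<noteq> {}" "isometric_to_one_point_extension X \<rho> Y d"
  shows "card (DP X \<rho>) = 2 * (card X - 1)"
proof -
  interpret Ultrametric_space Y d by fact
  obtain a t f where a: "a \<notin> Y" and t: "diam Y d < ereal t"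
    and f: "bij_betw f X (insert a Y)"
    and iso: "\<And>x y. x \<in> X \<Longrightarrow> y \<in> X \<Longrightarrow> \<rho> x y = ext_dist Y d a t (f x) (f y)"
    using assms(4) unfolding isometric_to_one_point_extension_def isometric_def by metis
  have lt: "d x y < t" if "x \<in> Y" "y \<in> Y" for x y
    using le_less_trans[OF dist_le_diam[of x Y y d] t] that by simp
  obtain y0 where y0: "y0 \<in> Y"
    using assms(3) by auto
  \<comment> \<open>This keeps the pair (p, p), at distance 0, out of the diametrical pairs.\<close>
  have t0: "t > 0"
    using lt[OF y0 y0] y0 by simp
  obtain p where p: "p \<in> X" "f p = a"
    using f by (metis bij_betw_iff_bijections insertI1)
  obtain q where q: "q \<in> X" "f q = y0"
    using f y0 by (metis bij_betw_iff_bijections insertI2)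
  have fa: "f x = a \<longleftrightarrow> x = p" if "x \<in> X" for x
    using f p that by (metis bij_betw_inv_into_left)
  have fY: "f x \<in> Y \<longleftrightarrow> x \<noteq> p" if "x \<in> X" for x
    using f that fa[OF that] a by (metis bij_betwE insertE)
  \<comment> \<open>The inequality of truth values says that exactly one of \<open>x\<close>,
    \<open>y\<close> is \<open>p\<close>.\<close>
  have far: "\<rho> x y = t" if "x \<in> X" "y \<in> X" "(x = p) \<noteq> (y = p)" for x y
    using that iso[of x y] fa fY a by (auto simp: ext_dist_def)
  have near: "\<rho> x y < t" if "x \<in> X" "y \<in> X" "(x = p) = (y = p)" for x y
    using that iso[of x y] fa fY lt t0 a p by (auto simp: ext_dist_def)
  have "p \<noteq> q"
    using p q y0 a by auto
  have "diam X \<rho> = ereal t"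
  proof (rule antisym)
    show "diam X \<rho> \<le> ereal t"
      by (rule diam_leI) (metis far near ereal_less_eq(3) less_imp_le order_refl)
    show "ereal t \<le> diam X \<rho>"
      using dist_le_diam[of p X q \<rho>] far[of p q] p q \<open>p \<noteq> q\<close> by simp
  qed
  then have "DP X \<rho> = {p} \<times> (X - {p}) \<union> (X - {p}) \<times> {p}"
    using far near p by (auto simp: DP_def)
  then show ?thesis
    using card_Times_Un_swap[of "{p}" "X - {p}"] assms(1) p by (simp add: card_Diff_singleton)
qed

lemma one_point_extension_of_Diff:
  assumes "Ultrametric_space X \<rho>" "finite X" "a \<in> X" "X - {a} \<noteq> {}"
    and DP: "DP X \<rho> = {a} \<times> (X - {a}) \<union> (X - {a}) \<times> {a}"
  shows "Ultrametric_space (X - {a}) \<rho>"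
    and "isometric_to_one_point_extension X \<rho> (X - {a}) \<rho>"
proof -
  interpret Ultrametric_space X \<rho> by fact
  show "Ultrametric_space (X - {a}) \<rho>"
    by unfold_locales (auto intro: commute triangle ultrametric)
  obtain t where t: "diam X \<rho> = ereal t"
    using diam_attained[of X \<rho>] assms(2,3) by blast
  have far: "\<rho> x a = t" "\<rho> a x = t" if "x \<in> X - {a}" for x
  proof -
    have "(x, a) \<in> DP X \<rho>" "(a, x) \<in> DP X \<rho>"
      using that by (auto simp: DP)
    then show "\<rho> x a = t" "\<rho> a x = t"
      by (auto simp: DP_def t)
  qed
  \<comment> \<open>Since the smaller diameter is attained at a pair avoiding \<open>a\<close>, and
    no such pair is diametrical in \<open>X\<close>, it is strictly below \<open>t\<close>.\<close>
  obtain u v where uv: "u \<in> X - {a}" "v \<in> X - {a}" "diam (X - {a}) \<rho> = ereal (\<rho> u v)"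
    using diam_attained[of "X - {a}" \<rho>] assms(2,4) by blast
  then have "(u, v) \<notin> DP X \<rho>"
    by (auto simp: DP)
  then have "diam (X - {a}) \<rho> < ereal t"
    using uv dist_le_diam[of u X v \<rho>] by (auto simp: DP_def t)
  \<comment> \<open>The identity is the isometry: \<open>t\<close> is the distance from
    \<open>a\<close> to every other point, and the last branch of \<open>ext_dist\<close> gives
    \<rho> a a = 0.\<close>
  moreover have "isometric X \<rho> (insert a (X - {a})) (ext_dist (X - {a}) \<rho> a t)"
    unfolding isometric_def
    by (rule exI[of _ id]) (use assms(3) far in \<open>auto simp: insert_absorb ext_dist_def\<close>)
  ultimately show "isometric_to_one_point_extension X \<rho> (X - {a}) \<rho>"
    unfolding isometric_to_one_point_extension_def by blast
qed

theorem theorem4p2: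
  fixes X :: "'a set" and \<rho> :: "'a \<Rightarrow> 'a \<Rightarrow> real"
  assumes "Ultrametric_space X \<rho>" and "finite X" and "card X \<ge> 2"
  shows "card (DP X \<rho>) \<ge> 2 * (card X - 1) \<and>
    (card (DP X \<rho>) = 2 * (card X - 1) \<longleftrightarrow>
      (\<exists>(Y :: 'a set) d. Ultrametric_space Y d \<and> Y \<noteq> {} \<and>
         isometric_to_one_point_extension X \<rho> Y d)) \<and>
    ((\<exists>(Y :: 'b set) d. Ultrametric_space Y d \<and> Y \<noteq> {} \<and>
         isometric_to_one_point_extension X \<rho> Y d)
      \<longrightarrow> card (DP X \<rho>) = 2 * (card X - 1))"
proof -
  obtain B C where BC: "B \<union> C = X" "B \<inter> C = {}" "B \<noteq> {}" "C \<noteq> {}"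
    and sub: "B \<times> C \<union> C \<times> B \<subseteq> DP X \<rho>"
    using assms by (rule DP_separation)
  have fin: "finite B" "finite C"
    using BC(1) assms(2) by auto
  have finDP: "finite (DP X \<rho>)"
    by (rule finite_subset[of _ "X \<times> X"]) (use assms(2) in \<open>auto simp: DP_def\<close>)
  have cX: "card X = card B + card C"
    using card_Un_disjoint[OF fin BC(2)] BC(1) by simp
  have pos: "card B \<ge> 1" "card C \<ge> 1"
    using fin BC by (auto simp: Suc_le_eq card_gt_0_iff)
  have cBC: "card (B \<times> C \<union> C \<times> B) = 2 * (card B * card C)"
    using card_Times_Un_swap fin BC(2) by blast
  have cle: "2 * (card B * card C) \<le> card (DP X \<rho>)"
    using card_mono[OF finDP sub] cBC by simp
  have lower: "card (DP X \<rho>) \<ge> 2 * (card X - 1)"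
    using cle add_le_Suc_mult(1)[OF pos] cX by linarith
  have "\<exists>(Y :: 'a set) d. Ultrametric_space Y d \<and> Y \<noteq> {} \<and>
         isometric_to_one_point_extension X \<rho> Y d"
    if eq: "card (DP X \<rho>) = 2 * (card X - 1)"
  proof -
    \<comment> \<open>With b, c the sizes of \<open>B\<close>, \<open>C\<close>, equality gives 2 b
      c \<le> 2 (b + c - 1), the reverse of the product bound.\<close>
    have "Suc (card B * card C) = card B + card C"
      using cle eq cX add_le_Suc_mult(1)[OF pos] pos by linarith
    then have one: "card B = 1 \<or> card C = 1" and "card (DP X \<rho>) = card (B \<times> C \<union> C \<times> B)"
      using add_le_Suc_mult(2)[OF pos] eq cX cBC by auto
    \<comment> \<open>A subset of a finite set with the same cardinality is the whole set.\<close>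
    then have DP: "DP X \<rho> = B \<times> C \<union> C \<times> B"
      using card_subset_eq[OF finDP sub] by simp
    from one obtain a where "B = {a} \<and> C = X - {a} \<or> C = {a} \<and> B = X - {a}"
      using BC by (auto simp: card_1_singleton_iff)
    then have "a \<in> X" "X - {a} \<noteq> {}" "DP X \<rho> = {a} \<times> (X - {a}) \<union> (X - {a}) \<times> {a}"
      using BC DP by auto
    then show ?thesis
      using one_point_extension_of_Diff[OF assms(1,2)] by blast
  qed
  \<comment> \<open>The converse lemma, polymorphic in the type of \<open>Y\<close>, serves both the
    equivalence and the last conjunct.\<close>
  then show ?thesis
    using lower by (blast intro: card_DP_one_point_extension[OF assms(2)])
qed

end
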